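(* Let $n\ge 1$ and let $S$ be a family of $n$ (distinct) finite sets. Then the set $\{u\oplus v : u,v\in S\}$ has size at least $2^{\lceil \lg n\rceil}$. Moreover, equality holds whenever $S$ is a family of $n$ (distinct) subsets of a set of size $\lceil \lg n\rceil$.
   Context: $\oplus$ denotes symmetric difference of sets and $\lg$ denotes the logarithm to base 2. In $\{u\oplus v : u,v\in S\}$ the case $u=v$ is allowed. *)

theory Defs
  imports Complex_Main
begin

end

theory Submission
  imports Defs
begin

text \<open>
  More generally, nonempty families \<open>A\<close> and \<open>B\<close> with \<open>|A| + |B| > 2\<^sup>k\<close> have at least \<open>2\<^sup>k\<close>
  symmetric differences; the theorem is the case \<open>A = B = S\<close>. The proof is by induction on \<open>k\<close>.
  If some point \<open>x\<close> splits both families (each has a member containing \<open>x\<close> and a member avoiding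
  \<open>x\<close>), write \<open>A = A\<^sub>0 \<union> A\<^sub>1\<close> and \<open>B = B\<^sub>0 \<union> B\<^sub>1\<close> accordingly. The differences avoiding \<open>x\<close> come from
  \<open>(A\<^sub>0, B\<^sub>0)\<close> and \<open>(A\<^sub>1, B\<^sub>1)\<close>, those containing \<open>x\<close> from \<open>(A\<^sub>0, B\<^sub>1)\<close> and \<open>(A\<^sub>1, B\<^sub>0)\<close>, and by pigeonhole
  the induction hypothesis applies to one pair of each kind. If no point splits both families,
  then all \<open>|A| |B| \<ge> |A| + |B| - 1\<close> differences are distinct.
\<close>

lemma finite_sym_diffs:
  assumes "finite A" "finite B"
  shows "finite {sym_diff u v | u v. u \<in> A \<and> v \<in> B}"
  using assms by (rule finite_image_set2[of "\<lambda>u. u \<in> A" "\<lambda>v. v \<in> B", simplified])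

lemma case_prod_image_Times: "(\<lambda>(x, y). f x y) ` (A \<times> B) = {f x y | x y. x \<in> A \<and> y \<in> B}"
  by force

lemma card_sym_diffs_ge:
  fixes A B :: "'a set set"
  assumes "finite A" "finite B" "A \<noteq> {}" "B \<noteq> {}" "2 ^ k < card A + card B"
  shows "2 ^ k \<le> card {sym_diff u v | u v. u \<in> A \<and> v \<in> B}"
  using assms
proof (induction k arbitrary: A B)
  case 0
  then have "{sym_diff u v | u v. u \<in> A \<and> v \<in> B} \<noteq> {}" by blast
  then show ?case
    using finite_sym_diffs[OF "0.prems"(1,2)] by (simp add: Suc_le_eq card_gt_0_iff)
next
  case (Suc k)
  let ?D = "\<lambda>A B :: 'a set set. {sym_diff u v | u v. u \<in> A \<and> v \<in> B}"
  have fin: "finite (?D A B)" using Suc.prems by (intro finite_sym_diffs)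
  show ?case
  proof (cases "\<exists>x. (\<exists>u\<in>A. x \<in> u) \<and> (\<exists>u\<in>A. x \<notin> u) \<and> (\<exists>v\<in>B. x \<in> v) \<and> (\<exists>v\<in>B. x \<notin> v)")
    case True
    then obtain x where x: "\<exists>u\<in>A. x \<in> u" "\<exists>u\<in>A. x \<notin> u" "\<exists>v\<in>B. x \<in> v" "\<exists>v\<in>B. x \<notin> v"
      by blast
    define A0 A1 B0 B1
      where "A0 = {u\<in>A. x \<notin> u}" and "A1 = {u\<in>A. x \<in> u}"
        and "B0 = {v\<in>B. x \<notin> v}" and "B1 = {v\<in>B. x \<in> v}"
    note defs = A0_def A1_def B0_def B1_def
    have fins: "finite A0" "finite A1" "finite B0" "finite B1"
      using Suc.prems by (auto simp: defs)
    \<comment> \<open>The induction hypothesis needs nonempty families, which is why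
      \<open>x\<close> must split both \<open>A\<close> and \<open>B\<close>.\<close>
    have ne: "A0 \<noteq> {}" "A1 \<noteq> {}" "B0 \<noteq> {}" "B1 \<noteq> {}"
      using x by (auto simp: defs)
    have "A = A0 \<union> A1" "A0 \<inter> A1 = {}" "B = B0 \<union> B1" "B0 \<inter> B1 = {}"
      by (auto simp: defs)
    then have "card A = card A0 + card A1" "card B = card B0 + card B1"
      using fins by (metis card_Un_disjoint)+
    then have big: "2 * 2 ^ k < card A0 + card A1 + (card B0 + card B1)"
      using Suc.prems(5) by simp
    let ?E = "{w \<in> ?D A B. x \<notin> w}" and ?F = "{w \<in> ?D A B. x \<in> w}"
    have transfer: "2 ^ k \<le> card W"
      if "2 ^ k < card A' + card B'" "finite A'" "finite B'" "A' \<noteq> {}" "B' \<noteq> {}"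
        "?D A' B' \<subseteq> W" "finite W" for A' B' W
      using Suc.IH[OF that(2-5) that(1)] card_mono[OF that(7,6)] by linarith
    have sub: "?D A0 B0 \<subseteq> ?E" "?D A1 B1 \<subseteq> ?E" "?D A0 B1 \<subseteq> ?F" "?D A1 B0 \<subseteq> ?F"
      unfolding defs by blast+
    have finEF: "finite ?E" "finite ?F" using fin by auto
    have "2 ^ k < card A0 + card B0 \<or> 2 ^ k < card A1 + card B1"
      using big by linarith
    then have E: "2 ^ k \<le> card ?E"
      using transfer[OF _ fins(1,3) ne(1,3) sub(1) finEF(1)]
        transfer[OF _ fins(2,4) ne(2,4) sub(2) finEF(1)] by blast
    have "2 ^ k < card A0 + card B1 \<or> 2 ^ k < card A1 + card B0"
      using big by linarith
    then have F: "2 ^ k \<le> card ?F"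
      using transfer[OF _ fins(1,4) ne(1,4) sub(3) finEF(2)]
        transfer[OF _ fins(2,3) ne(2,3) sub(4) finEF(2)] by blast
    have "card (?E \<union> ?F) = card ?E + card ?F"
      by (rule card_Un_disjoint[OF finEF]) auto
    moreover have "?E \<union> ?F = ?D A B" by blast
    ultimately show ?thesis using E F by simp
  next
    case False
    have "inj_on (\<lambda>(u, v). sym_diff u v) (A \<times> B)"
    proof (rule inj_onI, clarify)
      fix u v u' v'
      assume mem: "u \<in> A" "v \<in> B" "u' \<in> A" "v' \<in> B" and eq: "sym_diff u v = sym_diff u' v'"
      have pt: "(x \<in> u \<longleftrightarrow> x \<in> u') \<longleftrightarrow> (x \<in> v \<longleftrightarrow> x \<in> v')" for x
        using eq by blast
      \<comment> \<open>By \<open>pt\<close>, a point separating one of the pairs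
        \<open>u, u'\<close> and \<open>v, v'\<close> separates the other as well, so it would split
        both families.\<close>
      have "(x \<in> u \<longleftrightarrow> x \<in> u') \<and> (x \<in> v \<longleftrightarrow> x \<in> v')" for x
      proof (rule ccontr)
        assume "\<not> ?thesis"
        then have "(x \<in> u) \<noteq> (x \<in> u')" "(x \<in> v) \<noteq> (x \<in> v')" using pt[of x] by argo+
        then show False using False mem by metis
      qed
      then show "u = u' \<and> v = v'" by (simp add: set_eq_iff)
    qed
    then have "card (?D A B) = card A * card B"
      unfolding case_prod_image_Times[symmetric] by (simp only: card_image card_cartesian_product)
    \<comment> \<open>Here (a+1)(b+1) = ab + (a+b+1), and the strict bound
      \<open>2 ^ Suc k < a + b + 2\<close> absorbs the lost 1.\<close>
    moreover obtain a b where "card A = Suc a" "card B = Suc b"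
      using Suc.prems(1-4) by (metis card_gt_0_iff gr0_implies_Suc)
    ultimately show ?thesis using Suc.prems(5) by simp
  qed
qed

theorem theorem1p1:
  fixes S :: "'a set set" and n :: nat
  assumes "n \<ge> 1"
    and "finite S" and "card S = n"
    and "\<forall>u\<in>S. finite u"
  shows "2 ^ nat \<lceil>log 2 (real n)\<rceil> \<le> card {sym_diff u v | u v. u \<in> S \<and> v \<in> S}
    \<and> (\<forall>X. finite X \<longrightarrow> card X = nat \<lceil>log 2 (real n)\<rceil> \<longrightarrow> S \<subseteq> Pow X
         \<longrightarrow> card {sym_diff u v | u v. u \<in> S \<and> v \<in> S} = 2 ^ nat \<lceil>log 2 (real n)\<rceil>)"
proof -
  let ?k = "nat \<lceil>log 2 (real n)\<rceil>" and ?D = "{sym_diff u v | u v. u \<in> S \<and> v \<in> S}"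
  \<comment> \<open>Nonnegativity makes \<open>nat\<close> harmless. Rounding up adds less than 1,
    so \<open>2 ^ ?k\<close> stays strictly below 2n = |S| + |S|.\<close>
  have "0 \<le> log 2 (real n)" using assms(1) by simp
  then have "real ?k < log 2 (real n) + 1" by linarith
  then have "2 powr real ?k < 2 powr (log 2 (real n) + 1)" by simp
  also have "\<dots> = real (2 * n)" using assms(1) by (simp add: powr_add)
  finally have "real (2 ^ ?k) < real (2 * n)" by (simp add: powr_realpow)
  then have "2 ^ ?k < card S + card S" unfolding of_nat_less_iff assms(3) by simp
  moreover have "S \<noteq> {}" using assms by auto
  ultimately have lower: "2 ^ ?k \<le> card ?D"
    using assms(2) by (intro card_sym_diffs_ge)
  moreover have "card ?D = 2 ^ ?k" if X: "finite X" "card X = ?k" "S \<subseteq> Pow X" for X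
  proof -
    have "?D \<subseteq> Pow X" using X(3) by blast
    then have "card ?D \<le> card (Pow X)" using X(1) by (intro card_mono) auto
    then show ?thesis using lower X(1,2) by (simp add: card_Pow)
  qed
  ultimately show ?thesis by blast
qed

end
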